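(* Let $K,n\in\mathbb{N}$. Suppose that the prior density of $\theta^{(K)}=(\delta',\lambda_1^{(K)\prime},\ldots,\lambda_n^{(K)\prime},\eta')'$ under the $K$-component model $M_K$ is constrained by a regularity restriction, i.e. is proper and $$\pi(\theta^{(K)}|M_K)\propto\pi_{\underline{\delta}}(\delta|M_K)\left[\prod_{j=1}^{n}\prod_{i=1}^{K}\pi_{\underline{\lambda_{i,j}}}(\lambda_{i,j}|M_K)\right]\pi_{\underline{\eta}}(\eta|M_K)\,\mathbb{I}_{R_K}\{\zeta_K(\theta^{(K)})\},$$ where $\lambda_j^{(K)}=(\lambda_{1,j},\ldots,\lambda_{K,j})'$, $\pi_{\underline{\delta}}(\cdot|M_K)$, $\pi_{\underline{\lambda_{i,j}}}(\cdot|M_K)$, $\pi_{\underline{\eta}}(\cdot|M_K)$ are probability densities, $R_K\subset\mathbb{R}$, and $\zeta_K:\Theta^{(K)}\to\mathbb{R}$ is a function which, under the restrictions $\lambda_{1,j}=\lambda_{2,j}=\ldots=\lambda_{K,j}$ for all $j=1,\ldots,n$, does not depend on $\eta$. Then the coherent prior for $\theta^{(1)}=(\delta',\lambda_{1,1},\ldots,\lambda_{1,n})'$ under the single-component model $M_1$ is $$\pi(\theta^{(1)}|M_1)\propto\pi_{\underline{\delta}}(\delta|M_K)\left[\prod_{j=1}^{n}\prod_{i=1}^{K}\pi_{\underline{\lambda_{i,j}}}(\lambda_{1,j}|M_K)\right]\mathbb{I}_{R_K}\{\zeta_K(\delta,\lambda_{1,1}\iota_K,\lambda_{1,2}\iota_K,\ldots,\lambda_{1,n}\iota_K,\eta)\},$$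 where $\iota_K=(1,1,\ldots,1)'\in\mathbb{R}^K$, provided that the right-hand side has positive finite integral over $\theta^{(1)}$.
   Context: $M_K$ is a $K$-component (finite mixture or Markov-switching) model with parameters $\theta^{(K)}\in\Theta^{(K)}$: $\delta$ collects the non-mixture parameters, $\lambda_j^{(K)}\in\mathbb{R}^K$ ($j=1,\ldots,n$) the mixture parameters, and $\eta$ the probability parameters. $M_1$ is the single-component model with parameters $\theta^{(1)}$, nested in $M_K$ under $\lambda_{1,j}=\ldots=\lambda_{K,j}$ for all $j=1,\ldots,n$. $\mathbb{I}_R$ is the indicator function of the set $R$. Let $\tau_{i,j}=\lambda_{i,j}-\lambda_{1,j}$ ($i=2,\ldots,K$), $\tau_j=(\tau_{2,j},\ldots,\tau_{K,j})'$ (empty if $K=1$). The prior density of $(\delta,\lambda_{1,1},\tau_1,\ldots,\lambda_{1,n},\tau_n,\eta)$ under $M_K$ is the one obtained from $\pi(\theta^{(K)}|M_K)$ by substituting $\lambda_{i,j}=\tau_{i,j}+\lambda_{1,j}$ (unit Jacobian), evaluated pointwise. The coherent prior for $\theta^{(1)}$ under $M_1$ is the conditional prior of $(\delta,\lambda_{1,1},\ldots,\lambda_{1,n})$ given $\tau_1=\tau_2=\ldots=\tau_n=0$ under $M_K$: its density is obtained by setting all $\tau_j=0$ in that joint density, integrating out $\eta$, and normalizing over $\theta^{(1)}$. *)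

theory Defs
  imports "HOL-Probability.Probability"
begin

text \<open>
  The non-mixture parameters \<open>\<delta>\<close> and the probability parameters \<open>\<eta>\<close> range over the spaces of
  two reference measures \<open>D\<close> and \<open>E\<close> (for instance Lebesgue measure on a subset of a Euclidean
  space, or a surface measure on a simplex); densities are taken with respect to these, and
  with respect to Lebesgue measure for the mixture parameters.
  The mixture parameters are \<open>lam :: nat \<Rightarrow> nat \<Rightarrow> real\<close>, where \<open>lam j\<close> is the vector
  \<open>\<lambda>\<^sub>j\<close> in \<open>\<real>\<^sup>K\<close>; thus \<open>lam j i\<close> is \<open>\<lambda>\<^sub>i\<^sub>,\<^sub>j\<close>.
\<close>

definition is_density :: "'a measure \<Rightarrow> ('a \<Rightarrow> real) \<Rightarrow> bool" where
  "is_density M f \<longleftrightarrow>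
     f \<in> borel_measurable M \<and> (\<forall>x\<in>space M. 0 \<le> f x) \<and>
     prob_space (density M (\<lambda>x. ennreal (f x)))"

definition proportional_on :: "'a set \<Rightarrow> ('a \<Rightarrow> real) \<Rightarrow> ('a \<Rightarrow> real) \<Rightarrow> bool" where
  "proportional_on S f g \<longleftrightarrow> (\<exists>c>0. \<forall>x\<in>S. f x = c * g x)"

definition mixture_measure :: "nat \<Rightarrow> nat \<Rightarrow> (nat \<Rightarrow> nat \<Rightarrow> real) measure" where
  "mixture_measure K n = PiM {1..n} (\<lambda>j. PiM {1..K} (\<lambda>i. lborel))"

definition ThetaK :: "'d measure \<Rightarrow> 'e measure \<Rightarrow> nat \<Rightarrow> nat \<Rightarrow>
    ('d \<times> (nat \<Rightarrow> nat \<Rightarrow> real) \<times> 'e) measure" where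
  "ThetaK D E K n = D \<Otimes>\<^sub>M mixture_measure K n \<Otimes>\<^sub>M E"

definition Theta1 :: "'d measure \<Rightarrow> nat \<Rightarrow> ('d \<times> (nat \<Rightarrow> real)) measure" where
  "Theta1 D n = D \<Otimes>\<^sub>M PiM {1..n} (\<lambda>j. lborel)"

text \<open>
  The inverse of the reparametrization \<open>\<tau>\<^sub>i\<^sub>,\<^sub>j = \<lambda>\<^sub>i\<^sub>,\<^sub>j - \<lambda>\<^sub>1\<^sub>,\<^sub>j\<close> (for \<open>i = 2, \<dots>, K\<close>); here \<open>l j\<close> is
  \<open>\<lambda>\<^sub>1\<^sub>,\<^sub>j\<close> and \<open>tau j i\<close> is \<open>\<tau>\<^sub>i\<^sub>,\<^sub>j\<close>. Its Jacobian is 1, so \<open>tau_joint_density\<close> needs no factor.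
\<close>

definition lam_of_tau ::
    "nat \<Rightarrow> nat \<Rightarrow> (nat \<Rightarrow> real) \<Rightarrow> (nat \<Rightarrow> nat \<Rightarrow> real) \<Rightarrow> (nat \<Rightarrow> nat \<Rightarrow> real)" where
  "lam_of_tau K n l tau =
     (\<lambda>j\<in>{1..n}. \<lambda>i\<in>{1..K}. if i = 1 then l j else tau j i + l j)"

definition tau_joint_density ::
    "nat \<Rightarrow> nat \<Rightarrow> ('d \<times> (nat \<Rightarrow> nat \<Rightarrow> real) \<times> 'e \<Rightarrow> real) \<Rightarrow>
     'd \<Rightarrow> (nat \<Rightarrow> real) \<Rightarrow> (nat \<Rightarrow> nat \<Rightarrow> real) \<Rightarrow> 'e \<Rightarrow> real" where
  "tau_joint_density K n prior \<delta> l tau \<eta> = prior (\<delta>, lam_of_tau K n l tau, \<eta>)"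

definition tau_zero :: "nat \<Rightarrow> nat \<Rightarrow> (nat \<Rightarrow> nat \<Rightarrow> real)" where
  "tau_zero K n = (\<lambda>j\<in>{1..n}. \<lambda>i\<in>{2..K}. 0)"

definition coherent_kernel ::
    "'e measure \<Rightarrow> nat \<Rightarrow> nat \<Rightarrow> ('d \<times> (nat \<Rightarrow> nat \<Rightarrow> real) \<times> 'e \<Rightarrow> real) \<Rightarrow>
     'd \<times> (nat \<Rightarrow> real) \<Rightarrow> real" where
  "coherent_kernel E K n prior =
     (\<lambda>(\<delta>, l). \<integral>\<eta>. tau_joint_density K n prior \<delta> l (tau_zero K n) \<eta> \<partial>E)"

definition coherent_prior ::
    "'d measure \<Rightarrow> 'e measure \<Rightarrow> nat \<Rightarrow> nat \<Rightarrow>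
     ('d \<times> (nat \<Rightarrow> nat \<Rightarrow> real) \<times> 'e \<Rightarrow> real) \<Rightarrow> 'd \<times> (nat \<Rightarrow> real) \<Rightarrow> real" where
  "coherent_prior D E K n prior \<theta> =
     coherent_kernel E K n prior \<theta> / (\<integral>\<theta>'. coherent_kernel E K n prior \<theta>' \<partial>Theta1 D n)"

definition restricted_kernel ::
    "nat \<Rightarrow> nat \<Rightarrow> ('d \<Rightarrow> real) \<Rightarrow> (nat \<Rightarrow> nat \<Rightarrow> real \<Rightarrow> real) \<Rightarrow> ('e \<Rightarrow> real) \<Rightarrow>
     real set \<Rightarrow> ('d \<times> (nat \<Rightarrow> nat \<Rightarrow> real) \<times> 'e \<Rightarrow> real) \<Rightarrow>
     'd \<times> (nat \<Rightarrow> nat \<Rightarrow> real) \<times> 'e \<Rightarrow> real" where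
  "restricted_kernel K n p_delta p_lam p_eta R \<zeta> =
     (\<lambda>(\<delta>, lam, \<eta>). p_delta \<delta> * (\<Prod>j=1..n. \<Prod>i=1..K. p_lam i j (lam j i)) * p_eta \<eta> *
        indicator R (\<zeta> (\<delta>, lam, \<eta>)))"

text \<open>
  In the next kernel the last argument of \<open>\<zeta>\<close> is a fixed but arbitrary \<open>\<eta>\<close>.
\<close>

definition single_component_kernel ::
    "nat \<Rightarrow> nat \<Rightarrow> ('d \<Rightarrow> real) \<Rightarrow> (nat \<Rightarrow> nat \<Rightarrow> real \<Rightarrow> real) \<Rightarrow>
     real set \<Rightarrow> ('d \<times> (nat \<Rightarrow> nat \<Rightarrow> real) \<times> 'e \<Rightarrow> real) \<Rightarrow> 'e \<Rightarrow>
     'd \<times> (nat \<Rightarrow> real) \<Rightarrow> real" where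
  "single_component_kernel K n p_delta p_lam R \<zeta> \<eta> =
     (\<lambda>(\<delta>, l). p_delta \<delta> * (\<Prod>j=1..n. \<Prod>i=1..K. p_lam i j (l j)) *
        indicator R (\<zeta> (\<delta>, (\<lambda>j\<in>{1..n}. \<lambda>i\<in>{1..K}. l j), \<eta>)))"

end

theory Submission
  imports Defs
begin

text \<open>
  At \<open>\<tau> = 0\<close> all component parameters coincide: \<open>\<lambda>\<^sub>i\<^sub>,\<^sub>j = \<lambda>\<^sub>1\<^sub>,\<^sub>j\<close> for every \<open>i\<close>. There the regularity
  restriction no longer depends on \<open>\<eta>\<close>, so the restricted prior factorizes into a function of
  \<open>(\<delta>, \<lambda>\<^sub>1\<^sub>,\<^sub>1, \<dots>, \<lambda>\<^sub>1\<^sub>,\<^sub>n)\<close>, which is the single-component kernel up to the constant \<open>c\<close> of the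
  \<open>K\<close>-component prior, and the density of \<open>\<eta>\<close>. Integrating out \<open>\<eta>\<close> leaves \<open>c\<close> times the
  single-component kernel (\<open>coherent_kernel_eq\<close>); normalization cancels \<open>c\<close>, so the coherent prior
  is the normalized single-component kernel (\<open>is_density_normalized\<close>).

  The equalities hold at every point of the parameter space rather than almost everywhere. This is
  essential, because \<open>\<tau> = 0\<close> is a null set when \<open>K > 1\<close>.
\<close>

lemma is_density_integral:
  assumes "is_density M f"
  shows "(\<integral>x. f x \<partial>M) = 1"
proof -
  have f: "f \<in> borel_measurable M" and nonneg: "\<And>x. x \<in> space M \<Longrightarrow> 0 \<le> f x"
    and prob: "prob_space (density M (\<lambda>x. ennreal (f x)))"
    using assms by (auto simp: is_density_def)
  have "(\<integral>\<^sup>+x. ennreal (f x) \<partial>M) = emeasure (density M (\<lambda>x. ennreal (f x))) (space M)"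
    using f by (subst emeasure_density) (auto intro!: nn_integral_cong)
  also have "\<dots> = 1"
    using prob_space.emeasure_space_1[OF prob] by simp
  finally have "(\<integral>\<^sup>+x. ennreal (f x) \<partial>M) = 1" .
  with f nonneg show ?thesis
    by (subst integral_eq_nn_integral) auto
qed

lemma is_density_normalized:
  fixes g :: "'a \<Rightarrow> real"
  assumes int: "integrable M g"
    and nonneg: "\<And>x. x \<in> space M \<Longrightarrow> 0 \<le> g x"
    and pos: "0 < (\<integral>x. g x \<partial>M)"
    and f: "\<And>x. x \<in> space M \<Longrightarrow> f x = g x / (\<integral>x. g x \<partial>M)"
  shows "is_density M f"
proof -
  have f_nonneg: "0 \<le> f x" if "x \<in> space M" for x
    using that f nonneg pos by simp
  have f_int: "integrable M f"
    using int by (subst Bochner_Integration.integrable_cong[OF refl f]) auto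
  have "(\<integral>x. f x \<partial>M) = (\<integral>x. g x / (\<integral>x. g x \<partial>M) \<partial>M)"
    by (rule Bochner_Integration.integral_cong[OF refl f])
  also have "\<dots> = 1"
    using pos by simp
  finally have f_one: "(\<integral>x. f x \<partial>M) = 1" .
  have "emeasure (density M (\<lambda>x. ennreal (f x))) (space M) = (\<integral>\<^sup>+x. ennreal (f x) \<partial>M)"
    using f_int by (subst emeasure_density) (auto intro!: nn_integral_cong)
  also have "\<dots> = 1"
    using f_int f_nonneg f_one by (subst nn_integral_eq_integral) auto
  finally have "prob_space (density M (\<lambda>x. ennreal (f x)))"
    by (intro prob_spaceI) simp
  with f_int f_nonneg show ?thesis
    by (simp add: is_density_def)
qed

lemma lam_of_tau_zero:
  "lam_of_tau K n l (tau_zero K n) = (\<lambda>j\<in>{1..n}. \<lambda>i\<in>{1..K}. l j)"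
  by (auto simp: lam_of_tau_def tau_zero_def fun_eq_iff)

lemma diagonal_in_mixture_space:
  "(\<lambda>j\<in>{1..n}. \<lambda>i\<in>{1..K}. l j) \<in> space (mixture_measure K n)"
  by (auto simp: mixture_measure_def space_PiM)

lemma single_component_kernel_nonneg:
  assumes "is_density D p_delta"
    and "\<And>i j. i \<in> {1..K} \<Longrightarrow> j \<in> {1..n} \<Longrightarrow> is_density lborel (p_lam i j)"
    and "\<theta> \<in> space (Theta1 D n)"
  shows "0 \<le> single_component_kernel K n p_delta p_lam R \<zeta> \<eta> \<theta>"
  using assms
  by (auto simp: single_component_kernel_def Theta1_def space_pair_measure is_density_def
      intro!: mult_nonneg_nonneg prod_nonneg)

text \<open>
  On the diagonal the indicator can be evaluated at \<open>\<eta>\<^sub>0\<close> instead of the integration variable. It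
  then leaves the integral over \<open>\<eta>\<close> as a constant, and the density of \<open>\<eta>\<close> integrates to 1.
\<close>

lemma coherent_kernel_eq:
  fixes \<zeta> :: "'d \<times> (nat \<Rightarrow> nat \<Rightarrow> real) \<times> 'e \<Rightarrow> real"
  assumes p_eta: "is_density E p_eta"
    and prior: "\<And>\<theta>. \<theta> \<in> space (ThetaK D E K n) \<Longrightarrow>
           prior \<theta> = c * restricted_kernel K n p_delta p_lam p_eta R \<zeta> \<theta>"
    and no_eta: "\<And>\<delta> lam \<eta> \<eta>'.
           \<delta> \<in> space D \<Longrightarrow> lam \<in> space (mixture_measure K n) \<Longrightarrow>
           (\<forall>j\<in>{1..n}. \<forall>i\<in>{1..K}. lam j i = lam j 1) \<Longrightarrow>
           \<eta> \<in> space E \<Longrightarrow> \<eta>' \<in> space E \<Longrightarrow> \<zeta> (\<delta>, lam, \<eta>) = \<zeta> (\<delta>, lam, \<eta>')"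
    and \<eta>\<^sub>0: "\<eta>\<^sub>0 \<in> space E"
    and \<theta>: "\<theta> \<in> space (Theta1 D n)"
  shows "coherent_kernel E K n prior \<theta> =
         c * single_component_kernel K n p_delta p_lam R \<zeta> \<eta>\<^sub>0 \<theta>"
proof -
  obtain \<delta> l where \<theta>_eq: "\<theta> = (\<delta>, l)" and \<delta>: "\<delta> \<in> space D"
    using \<theta> by (auto simp: Theta1_def space_pair_measure)
  let ?lam = "\<lambda>j\<in>{1..n}. \<lambda>i\<in>{1..K}. l j"
  let ?g = "single_component_kernel K n p_delta p_lam R \<zeta> \<eta>\<^sub>0 \<theta>"
  have lam: "?lam \<in> space (mixture_measure K n)"
    by (rule diagonal_in_mixture_space)
  have prior_diag: "prior (\<delta>, ?lam, \<eta>) = c * ?g * p_eta \<eta>" if \<eta>: "\<eta> \<in> space E" for \<eta>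
  proof -
    have "\<zeta> (\<delta>, ?lam, \<eta>) = \<zeta> (\<delta>, ?lam, \<eta>\<^sub>0)"
      using no_eta[OF \<delta> lam _ \<eta> \<eta>\<^sub>0] by auto
    moreover have "(\<delta>, ?lam, \<eta>) \<in> space (ThetaK D E K n)"
      using \<delta> lam \<eta> by (simp add: ThetaK_def space_pair_measure)
    moreover have "(\<Prod>j=1..n. \<Prod>i=1..K. p_lam i j (?lam j i)) =
        (\<Prod>j=1..n. \<Prod>i=1..K. p_lam i j (l j))"
      by (intro prod.cong) auto
    ultimately show ?thesis
      using prior by (simp add: restricted_kernel_def single_component_kernel_def \<theta>_eq)
  qed
  have "coherent_kernel E K n prior \<theta> = (\<integral>\<eta>. prior (\<delta>, ?lam, \<eta>) \<partial>E)"
    by (simp add: coherent_kernel_def tau_joint_density_def lam_of_tau_zero \<theta>_eq)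
  also have "\<dots> = (\<integral>\<eta>. c * ?g * p_eta \<eta> \<partial>E)"
    by (rule Bochner_Integration.integral_cong[OF refl prior_diag])
  also have "\<dots> = c * ?g"
    using is_density_integral[OF p_eta] by simp
  finally show ?thesis .
qed

theorem mainTheorem10:
  fixes K n :: nat
    and D :: "'d measure" and E :: "'e measure"
    and prior :: "'d \<times> (nat \<Rightarrow> nat \<Rightarrow> real) \<times> 'e \<Rightarrow> real"
    and p_delta :: "'d \<Rightarrow> real" and p_lam :: "nat \<Rightarrow> nat \<Rightarrow> real \<Rightarrow> real" and p_eta :: "'e \<Rightarrow> real"
    and R :: "real set"
    and \<zeta> :: "'d \<times> (nat \<Rightarrow> nat \<Rightarrow> real) \<times> 'e \<Rightarrow> real"
    and \<eta>\<^sub>0 :: 'e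
  assumes "1 \<le> K" and "1 \<le> n"
    and "sigma_finite_measure D" and "sigma_finite_measure E"
    and "is_density D p_delta"
    and "\<And>i j. i \<in> {1..K} \<Longrightarrow> j \<in> {1..n} \<Longrightarrow> is_density lborel (p_lam i j)"
    and "is_density E p_eta"
    and proper: "is_density (ThetaK D E K n) prior"
    and "proportional_on (space (ThetaK D E K n)) prior
           (restricted_kernel K n p_delta p_lam p_eta R \<zeta>)"
    and no_eta: "\<And>\<delta> lam \<eta> \<eta>'.
           \<delta> \<in> space D \<Longrightarrow> lam \<in> space (mixture_measure K n) \<Longrightarrow>
           (\<forall>j\<in>{1..n}. \<forall>i\<in>{1..K}. lam j i = lam j 1) \<Longrightarrow>
           \<eta> \<in> space E \<Longrightarrow> \<eta>' \<in> space E \<Longrightarrow> \<zeta> (\<delta>, lam, \<eta>) = \<zeta> (\<delta>, lam, \<eta>')"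
    and "\<eta>\<^sub>0 \<in> space E"
    and "integrable (Theta1 D n) (single_component_kernel K n p_delta p_lam R \<zeta> \<eta>\<^sub>0)"
    and "0 < (\<integral>\<theta>. single_component_kernel K n p_delta p_lam R \<zeta> \<eta>\<^sub>0 \<theta> \<partial>Theta1 D n)"
  shows "is_density (Theta1 D n) (coherent_prior D E K n prior) \<and>
         proportional_on (space (Theta1 D n)) (coherent_prior D E K n prior)
           (single_component_kernel K n p_delta p_lam R \<zeta> \<eta>\<^sub>0)"
proof -
  let ?g = "single_component_kernel K n p_delta p_lam R \<zeta> \<eta>\<^sub>0"
  let ?I = "\<integral>\<theta>. ?g \<theta> \<partial>Theta1 D n"
  obtain c where c: "c > 0" and prior: "\<And>\<theta>. \<theta> \<in> space (ThetaK D E K n) \<Longrightarrow>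
      prior \<theta> = c * restricted_kernel K n p_delta p_lam p_eta R \<zeta> \<theta>"
    using assms(9) by (auto simp: proportional_on_def)
  have kernel: "coherent_kernel E K n prior \<theta> = c * ?g \<theta>" if "\<theta> \<in> space (Theta1 D n)" for \<theta>
    using assms(7) prior no_eta assms(11) that by (rule coherent_kernel_eq)
  have "(\<integral>\<theta>. coherent_kernel E K n prior \<theta> \<partial>Theta1 D n) = (\<integral>\<theta>. c * ?g \<theta> \<partial>Theta1 D n)"
    by (rule Bochner_Integration.integral_cong[OF refl kernel])
  then have total: "(\<integral>\<theta>. coherent_kernel E K n prior \<theta> \<partial>Theta1 D n) = c * ?I"
    by simp
  have coherent: "coherent_prior D E K n prior \<theta> = ?g \<theta> / ?I" if "\<theta> \<in> space (Theta1 D n)" for \<theta>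
    using c by (simp add: coherent_prior_def kernel[OF that] total)
  have "is_density (Theta1 D n) (coherent_prior D E K n prior)"
    using assms(12) single_component_kernel_nonneg[OF assms(5,6)] assms(13) coherent
    by (rule is_density_normalized)
  moreover have "proportional_on (space (Theta1 D n)) (coherent_prior D E K n prior) ?g"
    unfolding proportional_on_def
    using assms(13) coherent by (intro exI[of _ "1 / ?I"]) simp
  ultimately show ?thesis ..
qed

end
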